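(* Let $0\le\gamma<1$, $q\in(0,1)$, $k\ge 0$, $\alpha>0$, $\beta>-1$, and let $f(z)=z+\sum_{n=2}^\infty a_nz^n$ belong to $k\text{-}\mathcal{JUST}(q;\alpha,\beta,\gamma)$. Then for every real number $\eta$, $$|a_3-\eta a_2^2|\le\frac{1}{([3]_q-1)\psi_3}\times\begin{cases}P_2+\dfrac{P_1^2}{[2]_q-1}-\eta\dfrac{P_1^2([3]_q-1)\psi_3}{([2]_q-1)^2\psi_2^2},&\text{if }\eta\le\sigma_1,\\[2mm] P_1,&\text{if }\sigma_1\le\eta\le\sigma_2,\\[1mm] -P_2-\dfrac{P_1^2}{[2]_q-1}+\eta\dfrac{P_1^2([3]_q-1)\psi_3}{([2]_q-1)^2\psi_2^2},&\text{if }\eta\ge\sigma_2,\end{cases}$$ where $$\sigma_1=\frac{([2]_q-1)^2\psi_2^2}{([3]_q-1)\psi_3}\Big(\frac{P_2}{P_1^2}+\frac{1}{[2]_q-1}-\frac1{P_1}\Big),\qquad \sigma_2=\frac{([2]_q-1)^2\psi_2^2}{([3]_q-1)\psi_3}\Big(\frac{P_2}{P_1^2}+\frac{1}{[2]_q-1}+\frac1{P_1}\Big).$$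
   Context: $\mathcal{A}$ is the class of functions $f(z)=z+\sum_{n\ge2}a_nz^n$ analytic in $\mathbb{D}=\{z\in\mathbb{C}:|z|<1\}$. For $q\in(0,1)$, $[x]_q=\frac{1-q^x}{1-q}$, and $\Gamma_q$ is the $q$-gamma function, satisfying $\Gamma_q(x+1)=[x]_q\Gamma_q(x)$; for $n\ge2$ $$\psi_n:=\frac{\Gamma_q(\beta+n)}{\Gamma_q(\alpha+\beta+n)}\frac{\Gamma_q(\alpha+\beta+1)}{\Gamma_q(\beta+1)}=\prod_{j=1}^{n-1}\frac{[\beta+j]_q}{[\alpha+\beta+j]_q}.$$ The $q$-derivative is $(D_qg)(z)=\frac{g(z)-g(qz)}{(1-q)z}$ for $z\ne0$ and $(D_qg)(0)=g'(0)$. The generalized $q$-integral operator is $\chi^{\alpha}_{\beta,q}f(z)=z+\sum_{n=2}^\infty\psi_na_nz^n$. A function $f\in\mathcal{A}$ is in $k\text{-}\mathcal{JUST}(q;\alpha,\beta,\gamma)$ if and only if, with $p(z)=\frac{zD_q(\chi^{\alpha}_{\beta,q}f)(z)}{\chi^{\alpha}_{\beta,q}f(z)}$ (with $p(0)=1$; in particular $\chi^{\alpha}_{\beta,q}f(z)\neq0$ for $z\ne0$), one has $\operatorname{Re}p(z)>k|p(z)-1|+\gamma$ for all $z\in\mathbb{D}$. $P_1,P_2$ are the first Taylor coefficients of $p_{k,\gamma}(z)=1+P_1z+P_2z^2+\cdots$, the conformal map of $\mathbb{D}$ onto $\Omega_{k,\gamma}=\{u+iv:u>k\sqrt{(u-1)^2+v^2}+\gamma\}$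 with $p_{k,\gamma}(0)=1$, $p_{k,\gamma}'(0)>0$. Explicitly: for $0\le k<1$, $P_1=\frac{8(1-\gamma)(\arccos k)^2}{\pi^2(1-k^2)}$ and $P_2=\frac{A^2+2}{3}P_1$ with $A=\frac2\pi\arccos k$; for $k=1$, $P_1=\frac{8(1-\gamma)}{\pi^2}$ and $P_2=\frac23P_1$; for $k>1$, $P_1=\frac{\pi^2(1-\gamma)}{4\sqrt t(1+t)K^2(t)(k^2-1)}$ and $P_2=\frac{4K^2(t)(t^2+6t+1)-\pi^2}{24\sqrt tK^2(t)(1+t)}P_1$, where $K(t)=\int_0^1\frac{dx}{\sqrt{1-x^2}\sqrt{1-t^2x^2}}$, $K'(t)=K(\sqrt{1-t^2})$, and $t\in(0,1)$ is chosen with $k=\cosh\frac{\pi K'(t)}{4K(t)}$. *)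

theory Defs
  imports "HOL-Complex_Analysis.Complex_Analysis"
begin

definition q_num :: "real \<Rightarrow> real \<Rightarrow> real" where
  "q_num q x = (1 - q powr x) / (1 - q)"

definition q_Gamma :: "real \<Rightarrow> real \<Rightarrow> real" where
  "q_Gamma q x =
     (1 - q) powr (1 - x) * (\<Prod>i::nat. (1 - q powr (real i + 1)) / (1 - q powr (real i + x)))"

definition q_psi :: "real \<Rightarrow> real \<Rightarrow> real \<Rightarrow> nat \<Rightarrow> real" where
  "q_psi q \<alpha> \<beta> n =
     q_Gamma q (\<beta> + real n) / q_Gamma q (\<alpha> + \<beta> + real n) *
     (q_Gamma q (\<alpha> + \<beta> + 1) / q_Gamma q (\<beta> + 1))"

definition q_deriv :: "real \<Rightarrow> (complex \<Rightarrow> complex) \<Rightarrow> complex \<Rightarrow> complex" where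
  "q_deriv q g z =
     (if z = 0 then deriv g 0 else (g z - g (of_real q * z)) / ((1 - of_real q) * z))"

abbreviation taylor_coeff :: "(complex \<Rightarrow> complex) \<Rightarrow> nat \<Rightarrow> complex" where
  "taylor_coeff f n \<equiv> fps_nth (fps_expansion f 0) n"

definition class_A :: "(complex \<Rightarrow> complex) set" where
  "class_A = {f. f holomorphic_on ball 0 1 \<and> f 0 = 0 \<and> deriv f 0 = 1}"

definition q_integral_op ::
    "real \<Rightarrow> real \<Rightarrow> real \<Rightarrow> (complex \<Rightarrow> complex) \<Rightarrow> complex \<Rightarrow> complex" where
  "q_integral_op q \<alpha> \<beta> f z =
     z + (\<Sum>n. of_real (q_psi q \<alpha> \<beta> (n + 2)) * taylor_coeff f (n + 2) * z ^ (n + 2))"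

definition q_quotient ::
    "real \<Rightarrow> real \<Rightarrow> real \<Rightarrow> (complex \<Rightarrow> complex) \<Rightarrow> complex \<Rightarrow> complex" where
  "q_quotient q \<alpha> \<beta> f z =
     (if z = 0 then 1
      else z * q_deriv q (q_integral_op q \<alpha> \<beta> f) z / q_integral_op q \<alpha> \<beta> f z)"

text \<open>The non-vanishing condition is stated explicitly because division by zero is total.\<close>

definition k_JUST ::
    "real \<Rightarrow> real \<Rightarrow> real \<Rightarrow> real \<Rightarrow> real \<Rightarrow> (complex \<Rightarrow> complex) set" where
  "k_JUST k q \<alpha> \<beta> \<gamma> =
     {f \<in> class_A.
        (\<forall>z \<in> ball 0 1. z \<noteq> 0 \<longrightarrow> q_integral_op q \<alpha> \<beta> f z \<noteq> 0) \<and>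
        (\<forall>z \<in> ball 0 1.
           Re (q_quotient q \<alpha> \<beta> f z) > k * cmod (q_quotient q \<alpha> \<beta> f z - 1) + \<gamma>)}"

definition conic_domain :: "real \<Rightarrow> real \<Rightarrow> complex set" where
  "conic_domain k \<gamma> = {w. Re w > k * sqrt ((Re w - 1)\<^sup>2 + (Im w)\<^sup>2) + \<gamma>}"

text \<open>
  The conformal map of the disc onto the conic domain. Such a p exists, is unique on the unit
  disc and has real Taylor coefficients (proved below); its values off the disc are irrelevant.
\<close>

definition is_conic_map :: "real \<Rightarrow> real \<Rightarrow> (complex \<Rightarrow> complex) \<Rightarrow> bool" where
  "is_conic_map k \<gamma> p \<longleftrightarrow>
     p holomorphic_on ball 0 1 \<and> inj_on p (ball 0 1) \<and> p ` ball 0 1 = conic_domain k \<gamma> \<and>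
     p 0 = 1 \<and> Im (deriv p 0) = 0 \<and> Re (deriv p 0) > 0"

lemma q_Gamma_factor_pos:
  assumes "0 < q" "q < 1" "0 < x"
  shows "0 < 1 - q powr (real i + x)"
  using assms powr_less_mono'[of q 0 "real i + x"] by simp

lemma q_Gamma_factors_convergent:
  assumes "0 < q" "q < 1" "0 < x"
  shows "convergent_prod (\<lambda>i::nat. 1 - q powr (real i + x))"
proof -
  have "summable (\<lambda>i::nat. q powr x * q ^ i)"
    using assms by (intro summable_mult summable_geometric) auto
  hence "summable (\<lambda>i::nat. norm ((1 - q powr (real i + x)) - 1))"
    using assms by (simp add: powr_add powr_realpow mult.commute)
  thus ?thesis
    by (intro abs_convergent_prod_imp_convergent_prod summable_imp_abs_convergent_prod)
qed

lemma q_Gamma_pos: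
  assumes "0 < q" "q < 1" "0 < x"
  shows "0 < q_Gamma q x"
  unfolding q_Gamma_def
  using assms q_Gamma_factor_pos[of q] q_Gamma_factors_convergent[of q]
  by (intro mult_pos_pos less_0_prodinf convergent_prod_divide divide_pos_pos) auto

lemma q_Gamma_plus1:
  assumes "0 < q" "q < 1" "0 < x"
  shows "q_Gamma q (x + 1) = q_num q x * q_Gamma q x"
proof -
  define F where "F y = (\<Prod>i::nat. 1 - q powr (real i + y))" for y
  have conv: "convergent_prod (\<lambda>i::nat. 1 - q powr (real i + y))" if "y > 0" for y
    using assms that q_Gamma_factors_convergent by simp
  have nz: "1 - q powr (real i + y) \<noteq> 0" if "y > 0" for i y
    using assms that q_Gamma_factor_pos[of q y i] by simp
  have G: "q_Gamma q y = (1 - q) powr (1 - y) * (F 1 / F y)" if "y > 0" for y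
    using that prodinf_divide[OF conv[of 1] conv[of y]] unfolding q_Gamma_def F_def by simp
  have "F (x + 1) = (\<Prod>i::nat. 1 - q powr (real (Suc i) + x))"
    unfolding F_def by (simp add: add_ac)
  also have "\<dots> = F x / (1 - q powr (real 0 + x))"
    unfolding F_def using prodinf_split_head[OF conv[of x] nz[of x]] assms(3) by simp
  finally have FS: "F (x + 1) = F x / (1 - q powr x)" by simp
  have "(1 - q) powr (1 - x) = (1 - q) * (1 - q) powr (1 - (x + 1))"
    using assms powr_add[of "1 - q" 1 "- x"] by simp
  thus ?thesis
    using assms by (simp add: G FS q_num_def)
qed

lemma q_psi_eq_prod:
  assumes "0 < q" "q < 1" "\<alpha> > 0" "\<beta> > -1" "n \<ge> 1"
  shows "q_psi q \<alpha> \<beta> n = (\<Prod>j = 1..<n. q_num q (\<beta> + real j) / q_num q (\<alpha> + \<beta> + real j))"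
  using \<open>n \<ge> 1\<close>
proof (induction n rule: dec_induct)
  case base
  show ?case
    using assms q_Gamma_pos[of q "\<beta> + 1"] q_Gamma_pos[of q "\<alpha> + \<beta> + 1"]
    by (simp add: q_psi_def)
next
  case (step n)
  have b: "\<beta> + real n > 0" and ab: "\<alpha> + \<beta> + real n > 0" using step.hyps assms by auto
  have "q_Gamma q (\<beta> + real (Suc n)) = q_num q (\<beta> + real n) * q_Gamma q (\<beta> + real n)"
    using q_Gamma_plus1[OF assms(1,2) b] by (simp add: add_ac)
  moreover have "q_Gamma q (\<alpha> + \<beta> + real (Suc n)) =
      q_num q (\<alpha> + \<beta> + real n) * q_Gamma q (\<alpha> + \<beta> + real n)"
    using q_Gamma_plus1[OF assms(1,2) ab] by (simp add: add_ac)
  ultimately have "q_psi q \<alpha> \<beta> (Suc n) =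
      q_psi q \<alpha> \<beta> n * (q_num q (\<beta> + real n) / q_num q (\<alpha> + \<beta> + real n))"
    by (simp add: q_psi_def mult_ac)
  thus ?case using step by (simp add: prod.atLeastLessThan_Suc)
qed

lemma is_conic_map_subordination:
  assumes p: "is_conic_map k \<gamma> p"
    and holr: "r holomorphic_on ball 0 1" and r: "r ` ball 0 1 \<subseteq> conic_domain k \<gamma>" "r 0 = 1"
  obtains \<phi> where "\<phi> holomorphic_on ball 0 1" "\<phi> 0 = 0" "\<And>z. norm z < 1 \<Longrightarrow> norm (\<phi> z) < 1"
    "\<And>z. norm z < 1 \<Longrightarrow> r z = p (\<phi> z)" "deriv r 0 = deriv p 0 * deriv \<phi> 0"
proof -
  let ?D = "ball 0 1 :: complex set"
  have holp: "p holomorphic_on ?D" and img: "r ` ?D \<subseteq> p ` ?D" and "inj_on p ?D"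
    and [simp]: "p 0 = 1" "r 0 = 1"
    using p r by (auto simp: is_conic_map_def)
  obtain h where h: "h holomorphic_on p ` ?D" "\<And>z. z \<in> ?D \<Longrightarrow> h (p z) = z"
    using holomorphic_has_inverse[OF holp open_ball \<open>inj_on p ?D\<close>] by metis
  have rp: "\<exists>x\<in>?D. r z = p x" if "z \<in> ?D" for z
    using img that by blast
  define \<phi> where "\<phi> = h \<circ> r"
  have hol\<phi>: "\<phi> holomorphic_on ?D"
    unfolding \<phi>_def
    using holr holomorphic_on_subset[OF h(1) img] by (rule holomorphic_on_compose)
  have \<phi>0: "\<phi> 0 = 0" using h(2)[of 0] by (simp add: \<phi>_def)
  have into: "norm (\<phi> z) < 1" if "norm z < 1" for z
    using rp[of z] h(2) that by (auto simp: \<phi>_def)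
  have p\<phi>: "r z = p (\<phi> z)" if "norm z < 1" for z
    using rp[of z] h(2) that by (auto simp: \<phi>_def)
  have "deriv r 0 = deriv (p \<circ> \<phi>) 0"
    using eventually_nhds_in_open[OF open_ball, of 0 0 "1::real"] p\<phi>
    by (intro deriv_cong_ev) (auto elim!: eventually_mono)
  also have "\<dots> = deriv p (\<phi> 0) * deriv \<phi> 0"
    using holp hol\<phi> \<phi>0
    by (intro deriv_chain) (auto intro!: holomorphic_on_imp_differentiable_at[OF _ open_ball])
  finally show ?thesis
    using that[OF hol\<phi> \<phi>0 into p\<phi>] \<phi>0 by simp
qed

lemma is_conic_map_deriv_le:
  assumes p: "is_conic_map k \<gamma> p" and r: "is_conic_map k \<gamma> r"
  shows "norm (deriv r 0) \<le> norm (deriv p 0)"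
proof -
  have "r holomorphic_on ball 0 1" "r ` ball 0 1 \<subseteq> conic_domain k \<gamma>" "r 0 = 1"
    using r by (auto simp: is_conic_map_def)
  from is_conic_map_subordination[OF p this] obtain \<phi>
    where \<phi>: "\<phi> holomorphic_on ball 0 1" "\<phi> 0 = 0" "\<And>z. norm z < 1 \<Longrightarrow> norm (\<phi> z) < 1"
      "deriv r 0 = deriv p 0 * deriv \<phi> 0" by metis
  have "norm (deriv \<phi> 0) \<le> 1"
    using Schwarz_Lemma(2)[OF \<phi>(1-3), of 0] by simp
  thus ?thesis
    using \<phi>(4) by (simp add: norm_mult mult_left_le)
qed

lemma is_conic_map_unique:
  assumes p: "is_conic_map k \<gamma> p" and r: "is_conic_map k \<gamma> r" and z: "norm z < 1"
  shows "p z = r z"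
proof -
  have "r holomorphic_on ball 0 1" "r ` ball 0 1 \<subseteq> conic_domain k \<gamma>" "r 0 = 1"
    using r by (auto simp: is_conic_map_def)
  from is_conic_map_subordination[OF p this] obtain \<phi>
    where \<phi>: "\<phi> holomorphic_on ball 0 1" "\<phi> 0 = 0" "\<And>z. norm z < 1 \<Longrightarrow> norm (\<phi> z) < 1"
      "\<And>z. norm z < 1 \<Longrightarrow> r z = p (\<phi> z)" "deriv r 0 = deriv p 0 * deriv \<phi> 0" by metis
  have pos: "deriv p 0 = of_real (Re (deriv p 0))" "Re (deriv p 0) > 0"
      "deriv r 0 = of_real (Re (deriv r 0))" "Re (deriv r 0) > 0"
    using p r by (auto simp: is_conic_map_def complex_eq_iff)
  have "norm (deriv r 0) = norm (deriv p 0)"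
    using is_conic_map_deriv_le[OF p r] is_conic_map_deriv_le[OF r p] by simp
  hence "Re (deriv r 0) = Re (deriv p 0)"
    using pos by (metis abs_of_pos norm_of_real)
  hence "deriv r 0 = deriv p 0" using pos by simp
  hence d: "deriv \<phi> 0 = 1" using \<phi>(5) pos by auto
  have "\<exists>c. (\<forall>z. norm z < 1 \<longrightarrow> \<phi> z = c * z) \<and> norm c = 1"
    using Schwarz_Lemma(3)[OF \<phi>(1-3), of 0] d by simp
  then obtain c where c: "\<And>z. norm z < 1 \<Longrightarrow> \<phi> z = c * z" by blast
  have "deriv \<phi> 0 = deriv (\<lambda>z. c * z) 0"
    using eventually_nhds_in_open[OF open_ball, of 0 0 "1::real"] c
    by (intro deriv_cong_ev) (auto elim!: eventually_mono)
  hence "c = 1" using d by simp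
  thus ?thesis using c \<phi>(4) z by simp
qed

lemma has_field_derivative_cnj_cnj:
  assumes "(F has_field_derivative d) (at z)"
  shows "((\<lambda>w. cnj (F (cnj w))) has_field_derivative cnj d) (at (cnj z))"
proof -
  have "((\<lambda>h. (F (z + h) - F z) / h) \<longlongrightarrow> d) (at 0)"
    using assms by (simp add: DERIV_def)
  moreover have "filterlim cnj (at 0) (at (0::complex))"
    by (auto simp: filterlim_at eventually_at_filter intro!: tendsto_eq_intros)
  ultimately have "((\<lambda>h. (F (z + cnj h) - F z) / cnj h) \<longlongrightarrow> d) (at 0)"
    by (rule filterlim_compose)
  from tendsto_cnj[OF this] show ?thesis
    by (simp add: DERIV_def)
qed

lemma is_conic_map_cnj:
  assumes p: "is_conic_map k \<gamma> p"
  shows "is_conic_map k \<gamma> (\<lambda>z. cnj (p (cnj z)))"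
proof -
  let ?D = "ball 0 1 :: complex set"
  have D: "cnj ` ?D = ?D"
  proof
    show "?D \<subseteq> cnj ` ?D"
    proof
      fix z assume "z \<in> ?D"
      thus "z \<in> cnj ` ?D" by (intro image_eqI[of _ _ "cnj z"]) simp_all
    qed
  qed auto
  have \<Omega>: "cnj ` conic_domain k \<gamma> = conic_domain k \<gamma>"
  proof
    show "conic_domain k \<gamma> \<subseteq> cnj ` conic_domain k \<gamma>"
    proof
      fix z assume "z \<in> conic_domain k \<gamma>"
      thus "z \<in> cnj ` conic_domain k \<gamma>"
        by (intro image_eqI[of _ _ "cnj z"]) (simp_all add: conic_domain_def)
    qed
  qed (auto simp: conic_domain_def)
  have der: "(p has_field_derivative deriv p z) (at z)" if "z \<in> ?D" for z
    using p that unfolding is_conic_map_def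
    by (meson holomorphic_derivI open_ball)
  have der': "((\<lambda>w. cnj (p (cnj w))) has_field_derivative cnj (deriv p (cnj z))) (at z)"
    if "z \<in> ?D" for z
    using has_field_derivative_cnj_cnj[OF der[of "cnj z"]] that by simp
  have "(\<lambda>z. cnj (p (cnj z))) ` ?D = cnj ` p ` cnj ` ?D" by (simp add: image_image)
  also have "\<dots> = conic_domain k \<gamma>" using p by (simp add: D \<Omega> is_conic_map_def)
  finally have img: "(\<lambda>z. cnj (p (cnj z))) ` ?D = conic_domain k \<gamma>" .
  moreover have "(\<lambda>z. cnj (p (cnj z))) holomorphic_on ?D"
    using der' unfolding holomorphic_on_open[OF open_ball] by blast
  moreover have "inj_on (\<lambda>z. cnj (p (cnj z))) ?D"
  proof (rule inj_onI)
    fix x y assume "x \<in> ?D" "y \<in> ?D" "cnj (p (cnj x)) = cnj (p (cnj y))"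
    moreover have "inj_on p ?D" using p by (simp add: is_conic_map_def)
    ultimately have "cnj x = cnj y"
      using inj_onD[of p ?D "cnj x" "cnj y"] by simp
    thus "x = y" by simp
  qed
  moreover have "deriv (\<lambda>z. cnj (p (cnj z))) 0 = cnj (deriv p 0)"
    using der'[of 0] by (simp add: DERIV_imp_deriv)
  ultimately show ?thesis
    using p by (simp add: is_conic_map_def)
qed

lemma is_conic_map_taylor_coeff_real:
  assumes p: "is_conic_map k \<gamma> p"
  shows "taylor_coeff p n \<in> \<real>"
proof -
  let ?D = "ball 0 1 :: complex set"
  have hol: "(deriv ^^ n) p holomorphic_on ?D" for n
    using p by (intro holomorphic_higher_deriv) (auto simp: is_conic_map_def)
  have "\<forall>z\<in>?D. (deriv ^^ n) p z = cnj ((deriv ^^ n) p (cnj z))" for n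
  proof (induction n)
    case 0
    have "p z = cnj (p (cnj z))" if "z \<in> ?D" for z
      using is_conic_map_unique[OF p is_conic_map_cnj[OF p]] that by (simp only: mem_ball_0)
    thus ?case by (simp only: funpow_0) blast
  next
    case (Suc n)
    let ?F = "(deriv ^^ n) p"
    show ?case
    proof
      fix z assume z: "z \<in> ?D"
      have "(?F has_field_derivative deriv ?F (cnj z)) (at (cnj z))"
        using hol[of n] z by (intro holomorphic_derivI[OF _ open_ball]) auto
      from has_field_derivative_cnj_cnj[OF this]
      have "((\<lambda>w. cnj (?F (cnj w))) has_field_derivative cnj (deriv ?F (cnj z))) (at z)"
        by simp
      hence "(?F has_field_derivative cnj (deriv ?F (cnj z))) (at z)"
        by (rule has_field_derivative_transform_within_open[OF _ open_ball z])
           (rule Suc[rule_format, symmetric])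
      thus "(deriv ^^ Suc n) p z = cnj ((deriv ^^ Suc n) p (cnj z))"
        by (simp add: DERIV_imp_deriv)
    qed
  qed
  hence "(deriv ^^ n) p 0 = cnj ((deriv ^^ n) p (cnj 0))"
    by (rule bspec) simp
  hence "(deriv ^^ n) p 0 \<in> \<real>"
    unfolding Reals_cnj_iff complex_cnj_zero by (rule sym)
  moreover have "(fact n :: complex) \<in> \<real>"
    by (metis of_nat_fact Reals_of_nat)
  ultimately show ?thesis
    by (simp add: fps_expansion_def Reals_divide)
qed

lemma is_conic_map_exists:
  assumes "0 \<le> k" "0 \<le> \<gamma>" "\<gamma> < 1"
  shows "\<exists>p. is_conic_map k \<gamma> p"
proof -
  let ?D = "ball 0 1 :: complex set" and ?\<Omega> = "conic_domain k \<gamma>"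
  have eq: "?\<Omega> = {w. k * norm (w - 1) + \<gamma> < Re w}"
    by (simp add: conic_domain_def cmod_def)
  have op: "open ?\<Omega>"
    unfolding eq by (intro open_Collect_less continuous_intros)
  have "convex ?\<Omega>"
    unfolding convex_def
  proof (intro ballI allI impI)
    fix x y :: complex and u v :: real
    assume xy: "x \<in> ?\<Omega>" "y \<in> ?\<Omega>" and uv: "0 \<le> u" "0 \<le> v" "u + v = 1"
    have "u *\<^sub>R x + v *\<^sub>R y - 1 = u *\<^sub>R (x - 1) + v *\<^sub>R (y - 1)"
      using uv(3) by (simp add: complex_eq_iff algebra_simps)
    hence "norm (u *\<^sub>R x + v *\<^sub>R y - 1) \<le> u * norm (x - 1) + v * norm (y - 1)"
      using uv norm_triangle_ineq[of "u *\<^sub>R (x - 1)" "v *\<^sub>R (y - 1)"] by simp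
    hence "k * norm (u *\<^sub>R x + v *\<^sub>R y - 1) \<le> k * (u * norm (x - 1) + v * norm (y - 1))"
      using \<open>0 \<le> k\<close> by (rule mult_left_mono)
    moreover have "u * \<gamma> + v * \<gamma> = \<gamma>"
      using uv(3) by (simp flip: distrib_right)
    ultimately have "k * norm (u *\<^sub>R x + v *\<^sub>R y - 1) + \<gamma> \<le>
        u * (k * norm (x - 1) + \<gamma>) + v * (k * norm (y - 1) + \<gamma>)"
      by (simp add: distrib_left mult.left_commute)
    also have "\<dots> < u * Re x + v * Re y"
    proof (cases "u = 0")
      case True thus ?thesis using xy uv by (simp add: eq)
    next
      case False
      hence "u * (k * norm (x - 1) + \<gamma>) < u * Re x"
        using xy uv by (intro mult_strict_left_mono) (auto simp: eq)
      moreover have "v * (k * norm (y - 1) + \<gamma>) \<le> v * Re y"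
        using xy uv by (intro mult_left_mono) (auto simp: eq)
      ultimately show ?thesis by linarith
    qed
    finally show "u *\<^sub>R x + v *\<^sub>R y \<in> ?\<Omega>" by (simp add: eq)
  qed
  hence sc: "simply_connected ?\<Omega>" by (rule convex_imp_simply_connected)
  have one: "1 \<in> ?\<Omega>" using assms by (simp add: eq)
  have "k * norm (0 - 1 :: complex) + \<gamma> \<ge> 0" using assms by simp
  hence "0 \<notin> ?\<Omega>" by (simp add: eq)
  hence "?\<Omega> \<noteq> UNIV" "?\<Omega> \<noteq> {}" using one by auto
  then obtain f g where fg: "f holomorphic_on ?\<Omega>" "g holomorphic_on ?D"
      "\<And>z. z \<in> ?\<Omega> \<Longrightarrow> f z \<in> ?D \<and> g (f z) = z"
      "\<And>z. z \<in> ?D \<Longrightarrow> g z \<in> ?\<Omega> \<and> f (g z) = z"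
    using simply_connected_eq_biholomorphic_to_disc[OF op] sc by metis
  obtain m m' where m: "m' (f 1) = 0" "m' holomorphic_on ?D" "m' \<in> ?D \<rightarrow> ?D"
      "m holomorphic_on ?D" "m \<in> ?D \<rightarrow> ?D"
      "\<And>z. z \<in> ?D \<Longrightarrow> m' (m z) = z" "\<And>z. z \<in> ?D \<Longrightarrow> m (m' z) = z"
    using ball_biholomorphism_exists[of "f 1"] fg(3)[OF one] by (metis image_subset_iff_funcset)
  define Q where "Q z = g (m z)" for z
  have mD: "m z \<in> ?D" "m' z \<in> ?D" if "z \<in> ?D" for z
    using m(3,5) that by (blast dest: funcset_mem)+
  have fD: "f w \<in> ?D" "g (f w) = w" if "w \<in> ?\<Omega>" for w
    using fg(3)[OF that] by (blast+)
  have gD: "g z \<in> ?\<Omega>" "f (g z) = z" if "z \<in> ?D" for z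
    using fg(4)[OF that] by (blast+)
  have "g \<circ> m holomorphic_on ?D"
    by (rule holomorphic_on_compose_gen[OF m(4) fg(2)]) (use mD(1) in blast)
  hence holQ: "Q holomorphic_on ?D"
    by (simp add: Q_def[abs_def] o_def)
  have inv: "m' (f (Q z)) = z" if "z \<in> ?D" for z
    unfolding Q_def gD(2)[OF mD(1)[OF that]] by (rule m(6)[OF that])
  have injQ: "inj_on Q ?D" by (rule inj_on_inverseI[of _ "\<lambda>w. m' (f w)"]) (rule inv)
  have imQ: "Q ` ?D = ?\<Omega>"
  proof
    show "Q ` ?D \<subseteq> ?\<Omega>" unfolding Q_def using gD(1) mD(1) by blast
    show "?\<Omega> \<subseteq> Q ` ?D"
    proof
      fix w assume w: "w \<in> ?\<Omega>"
      show "w \<in> Q ` ?D"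
      proof (rule image_eqI)
        show "m' (f w) \<in> ?D" by (rule mD(2)[OF fD(1)[OF w]])
        show "w = Q (m' (f w))"
          unfolding Q_def m(7)[OF fD(1)[OF w]] fD(2)[OF w] ..
      qed
    qed
  qed
  have Q0: "Q 0 = 1" using m(1) m(7)[OF fD(1)[OF one]] fD(2)[OF one] by (simp add: Q_def)
  define d where "d = deriv Q 0"
  have d: "d \<noteq> 0"
    unfolding d_def using holomorphic_injective_imp_regular[OF holQ open_ball injQ] by simp
  define c where "c = cnj d / of_real (norm d)"
  have c: "norm c = 1" using d by (simp add: c_def norm_divide)
  have cD: "(\<lambda>z. c * z) ` ?D = ?D"
  proof
    show "?D \<subseteq> (\<lambda>z. c * z) ` ?D"
    proof
      fix z :: complex assume "z \<in> ?D"
      moreover have "z = c * (z / c)" using c by auto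
      ultimately show "z \<in> (\<lambda>z. c * z) ` ?D"
        using c by (intro image_eqI[of _ _ "z / c"]) (auto simp: norm_divide)
    qed
  qed (use c in \<open>auto simp: norm_mult\<close>)
  have "(\<lambda>z. Q (c * z)) holomorphic_on ?D"
  proof -
    have "Q \<circ> (\<lambda>z. c * z) holomorphic_on ?D"
      by (rule holomorphic_on_compose) (use holQ cD in \<open>auto intro!: holomorphic_intros\<close>)
    thus ?thesis by (simp add: o_def)
  qed
  moreover have "inj_on (\<lambda>z. Q (c * z)) ?D"
  proof (rule inj_onI)
    fix x y assume "x \<in> ?D" "y \<in> ?D" "Q (c * x) = Q (c * y)"
    hence "c * x = c * y" using inj_onD[OF injQ, of "c * x" "c * y"] c by (simp add: norm_mult)
    thus "x = y" using c by auto
  qed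
  moreover have "(\<lambda>z. Q (c * z)) ` ?D = ?\<Omega>"
    using imQ cD image_image[of Q "\<lambda>z. c * z" ?D] by simp
  moreover have "deriv (\<lambda>z. Q (c * z)) 0 = of_real (norm d)"
  proof -
    have "(Q has_field_derivative d) (at (c * 0))"
      unfolding d_def using holomorphic_derivI[OF holQ open_ball, of 0] by simp
    hence "((\<lambda>z. Q (c * z)) has_field_derivative d * c) (at 0)"
      by (rule DERIV_chain2) (auto intro!: derivative_eq_intros)
    moreover have "d * c = of_real (norm d)"
      using d by (simp add: c_def complex_norm_square[symmetric] field_simps power2_eq_square)
    ultimately show ?thesis by (simp add: DERIV_imp_deriv)
  qed
  ultimately have "is_conic_map k \<gamma> (\<lambda>z. Q (c * z))"
    using Q0 d by (simp add: is_conic_map_def)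
  thus ?thesis by blast
qed

end

theory Submission
  imports Defs
begin

text \<open>
  Let \<open>g\<close> be the \<open>q\<close>-integral transform of \<open>f\<close>. It is divisible by \<open>z\<close>, with quotient
  \<open>G z = g z / z\<close> free of zeros in the disc, and
  \<open>z D\<^sub>q g z / g z = (G z - q G (q z)) / ((1 - q) G z)\<close>. The right-hand side is holomorphic on the
  whole disc, maps it into the conic domain, and takes the value 1 at 0. It is therefore subordinate
  to the conformal map \<open>p\<close>: it equals \<open>p \<circ> \<phi>\<close> for a Schwarz function
  \<open>\<phi> z = c\<^sub>1 z + c\<^sub>2 z\<^sup>2 + \<dots>\<close>. Comparing the coefficients of \<open>z\<close> and \<open>z\<^sup>2\<close> expresses \<open>a\<^sub>2\<close> and
  \<open>a\<^sub>3\<close> through \<open>c\<^sub>1\<close> and \<open>c\<^sub>2\<close> (lemma \<open>k_JUST_coeffs\<close>), and after clearing the factor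
  \<open>([3] - 1) \<psi>\<^sub>3\<close> the Fekete--Szego functional takes the form \<open>P\<^sub>1 c\<^sub>2 + M c\<^sub>1\<^sup>2\<close>, where \<open>M\<close> is
  affine and decreasing in \<open>\<eta>\<close>, and real because the symmetry of the conic domain in the real axis
  makes the coefficients of \<open>p\<close> real.

  For a Schwarz function \<open>|c\<^sub>2| \<le> 1 - |c\<^sub>1|\<^sup>2\<close>: this is the Schwarz--Pick inequality at 0 for
  \<open>\<phi> z / z\<close>. Hence \<open>|P\<^sub>1 c\<^sub>2 + M c\<^sub>1\<^sup>2|\<close> is at most a convex combination of \<open>P\<^sub>1\<close> and \<open>|M|\<close>, so at
  most \<open>max P\<^sub>1 |M|\<close> (lemma \<open>Fekete_Szego_Schwarz\<close>). The thresholds \<open>\<sigma>\<^sub>1\<close> and \<open>\<sigma>\<^sub>2\<close> are the values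
  of \<open>\<eta>\<close> at which \<open>M = P\<^sub>1\<close> and \<open>M = - P\<^sub>1\<close>, and the three cases of the theorem say which of
  \<open>M\<close>, \<open>P\<^sub>1\<close>, \<open>- M\<close> is that maximum.
\<close>

section \<open>The multipliers of the \<open>q\<close>-integral operator\<close>

lemma q_num_of_nat:
  assumes "0 < q"
  shows "q_num q (real n) = (1 - q ^ n) / (1 - q)"
  using assms by (simp add: q_num_def powr_realpow)

lemma q_num_2_minus_1:
  assumes "0 < q" "q < 1"
  shows "q_num q 2 - 1 = q"
proof -
  have "1 - q\<^sup>2 = (1 - q) * (1 + q)" by algebra
  thus ?thesis using assms q_num_of_nat[of q 2] by simp
qed

lemma q_num_3_minus_1:
  assumes "0 < q" "q < 1"
  shows "q_num q 3 - 1 = q * (1 + q)"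
proof -
  have "1 - q ^ 3 = (1 - q) * (1 + q * (1 + q))" by algebra
  thus ?thesis using assms q_num_of_nat[of q 3] by simp
qed

lemma q_num_pos:
  assumes "0 < q" "q < 1" "0 < x"
  shows "0 < q_num q x"
  using assms powr_less_mono'[of q 0 x] by (simp add: q_num_def)

lemma q_num_mono:
  assumes "0 < q" "q < 1" "x \<le> y"
  shows "q_num q x \<le> q_num q y"
  using assms powr_mono'[of x y q] by (simp add: q_num_def divide_right_mono)

lemma q_psi_pos:
  assumes "0 < q" "q < 1" "\<alpha> > 0" "\<beta> > -1" "n \<ge> 1"
  shows "0 < q_psi q \<alpha> \<beta> n"
  unfolding q_psi_eq_prod[OF assms]
  using assms by (intro prod_pos divide_pos_pos q_num_pos ballI) auto

text \<open>
  Every factor of \<open>\<psi>\<^sub>n\<close> is a quotient of \<open>q\<close>-numbers whose denominator has the larger argument. The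
  bound ensures that the \<open>q\<close>-integral operator does not shrink the disc of convergence.
\<close>

lemma q_psi_le_1:
  assumes "0 < q" "q < 1" "\<alpha> > 0" "\<beta> > -1" "n \<ge> 1"
  shows "q_psi q \<alpha> \<beta> n \<le> 1"
  unfolding q_psi_eq_prod[OF assms]
proof (intro prod_le_1 conjI)
  fix j assume "j \<in> {1..<n}"
  hence pos: "0 < q_num q (\<beta> + real j)" "0 < q_num q (\<alpha> + \<beta> + real j)"
    using assms by (auto intro!: q_num_pos)
  thus "0 \<le> q_num q (\<beta> + real j) / q_num q (\<alpha> + \<beta> + real j)" by simp
  show "q_num q (\<beta> + real j) / q_num q (\<alpha> + \<beta> + real j) \<le> 1"
    using pos(2) assms q_num_mono[of q "\<beta> + real j" "\<alpha> + \<beta> + real j"] by simp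
qed

section \<open>Coefficients of Schwarz functions\<close>

text \<open>
  Composing \<open>h\<close> with the disc automorphism that moves \<open>h 0\<close> to 0 gives a function to which the
  Schwarz lemma applies; the automorphism multiplies the derivative at 0 by
  \<open>1 / (1 - |h 0|\<^sup>2)\<close>.
\<close>

lemma Schwarz_Pick_at_0:
  assumes hol: "h holomorphic_on ball 0 1" and h: "\<And>z. norm z < 1 \<Longrightarrow> norm (h z) < 1"
  shows "norm (deriv h 0) \<le> 1 - (norm (h 0))\<^sup>2"
proof -
  define w where "w = h 0"
  have w: "norm w < 1" using h[of 0] by (simp add: w_def)
  define g where "g = Moebius_function 0 w \<circ> h"
  have "g holomorphic_on ball 0 1"
    unfolding g_def
    by (rule holomorphic_on_compose_gen[OF hol Moebius_function_holomorphic[OF w]])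
       (use h in auto)
  moreover have "g 0 = 0"
    by (simp add: g_def w_def Moebius_function_eq_zero)
  moreover have "norm (g z) < 1" if "norm z < 1" for z
    using Moebius_function_norm_lt_1[OF w h[OF that]] by (simp add: g_def)
  ultimately have le: "norm (deriv g 0) \<le> 1"
    using Schwarz_Lemma(2)[of g 0] by simp
  have pos: "0 < 1 - (norm w)\<^sup>2"
    using w by (simp add: abs_square_less_1)
  have cw: "1 - cnj w * w = of_real (1 - (norm w)\<^sup>2)"
    by (simp add: complex_norm_square mult.commute del: of_real_power)
  have nz: "1 - cnj w * w \<noteq> 0"
    unfolding cw using pos by (metis less_irrefl of_real_eq_0_iff)
  have "(h has_field_derivative deriv h 0) (at 0)"
    using holomorphic_derivI[OF hol open_ball, of 0] by simp
  hence "((\<lambda>z. (h z - w) / (1 - cnj w * h z)) has_field_derivative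
          deriv h 0 / (1 - cnj w * w)) (at 0)"
    using nz by (auto intro!: derivative_eq_intros simp: w_def[symmetric])
  hence "deriv g 0 = deriv h 0 / of_real (1 - (norm w)\<^sup>2)"
    unfolding cw g_def o_def Moebius_function_simple by (rule DERIV_imp_deriv)
  hence "norm (deriv g 0) = norm (deriv h 0) / (1 - (norm w)\<^sup>2)"
    using pos by (simp add: norm_divide del: of_real_diff of_real_power)
  thus ?thesis
    using le pos by (simp add: w_def[symmetric])
qed

text \<open>
  The first two coefficients of \<open>\<phi>\<close> are the value and the derivative at 0 of \<open>h z = \<phi> z / z\<close>. By
  the Schwarz lemma, \<open>h\<close> maps the disc into itself, unless \<open>\<phi>\<close> is a rotation,
  whose second coefficient vanishes.
\<close>

lemma Schwarz_second_coeff: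
  assumes hol: "\<phi> holomorphic_on ball 0 1" and "\<phi> 0 = 0"
    and lt: "\<And>z. norm z < 1 \<Longrightarrow> norm (\<phi> z) < 1"
  shows "norm (taylor_coeff \<phi> 2) \<le> 1 - (norm (taylor_coeff \<phi> 1))\<^sup>2"
proof -
  obtain h where h: "h holomorphic_on ball 0 1" "\<And>z. norm z < 1 \<Longrightarrow> \<phi> z = z * h z"
      "deriv \<phi> 0 = h 0"
    using Schwarz3[OF hol \<open>\<phi> 0 = 0\<close>] by metis
  have ev: "eventually (\<lambda>z::complex. norm z < 1) (nhds 0)"
    using eventually_nhds_in_open[OF open_ball, of 0 0 "1::real"]
    by (auto elim!: eventually_mono)
  have "(\<lambda>z. z * h z) has_fps_expansion fps_X * fps_expansion h 0"
    by (intro fps_expansion_intros has_fps_expansion_fps_expansion[OF open_ball _ h(1)]) auto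
  hence "\<phi> has_fps_expansion fps_X * fps_expansion h 0"
    by (rule has_fps_expansion_cong[THEN iffD2, rotated -1])
       (use ev h(2) in \<open>auto elim!: eventually_mono\<close>)
  moreover have "\<phi> has_fps_expansion fps_expansion \<phi> 0"
    by (rule has_fps_expansion_fps_expansion[OF open_ball _ hol]) auto
  ultimately have "fps_expansion \<phi> 0 = fps_X * fps_expansion h 0"
    by (rule fps_expansion_unique_complex[rotated])
  hence c: "taylor_coeff \<phi> 1 = h 0" "taylor_coeff \<phi> 2 = deriv h 0"
    by (simp_all add: fps_expansion_def)
  show ?thesis
  proof (cases "(\<exists>z. norm z < 1 \<and> z \<noteq> 0 \<and> norm (\<phi> z) = norm z) \<or> norm (deriv \<phi> 0) = 1")
    case True
    have "\<exists>\<alpha>. (\<forall>z. norm z < 1 \<longrightarrow> \<phi> z = \<alpha> * z) \<and> norm \<alpha> = 1"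
      by (rule Schwarz_Lemma(3)[OF hol \<open>\<phi> 0 = 0\<close> lt _ True, of 0]) auto
    then obtain \<alpha> where \<alpha>: "\<And>z. norm z < 1 \<Longrightarrow> \<phi> z = \<alpha> * z" "norm \<alpha> = 1" by blast
    have "(\<lambda>z. \<alpha> * z) has_fps_expansion fps_const \<alpha> * fps_X"
      by (intro fps_expansion_intros)
    hence "\<phi> has_fps_expansion fps_const \<alpha> * fps_X"
      by (rule has_fps_expansion_cong[THEN iffD2, rotated -1])
         (use ev \<alpha>(1) in \<open>auto elim!: eventually_mono\<close>)
    hence "fps_expansion \<phi> 0 = fps_const \<alpha> * fps_X"
      by (rule fps_expansion_unique_complex[OF \<open>\<phi> has_fps_expansion fps_expansion \<phi> 0\<close>])
    thus ?thesis using \<alpha>(2) by simp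
  next
    case False
    have "norm (h z) < 1" if z: "norm z < 1" for z
    proof (cases "z = 0")
      case True
      thus ?thesis
        using False h(3) Schwarz_Lemma(2)[OF hol \<open>\<phi> 0 = 0\<close> lt, of 0] by simp
    next
      case z0: False
      have "norm (\<phi> z) < norm z"
        using False z z0 Schwarz_Lemma(1)[OF hol \<open>\<phi> 0 = 0\<close> lt z] by fastforce
      thus ?thesis using z0 h(2)[OF z] by (simp add: norm_mult)
    qed
    thus ?thesis using Schwarz_Pick_at_0[OF h(1)] c by simp
  qed
qed

text \<open>
  The bound on the second coefficient makes the estimate a convex combination of \<open>A\<close> and \<open>|M|\<close>
  with weights \<open>1 - |c\<^sub>1|\<^sup>2\<close> and \<open>|c\<^sub>1|\<^sup>2\<close>.
\<close>

lemma Fekete_Szego_Schwarz: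
  fixes A :: real and M :: complex
  assumes hol: "\<phi> holomorphic_on ball 0 1" and "\<phi> 0 = 0"
    and lt: "\<And>z. norm z < 1 \<Longrightarrow> norm (\<phi> z) < 1" and "0 \<le> A"
  shows "norm (of_real A * taylor_coeff \<phi> 2 + M * (taylor_coeff \<phi> 1)\<^sup>2) \<le> max A (norm M)"
proof -
  let ?x = "(norm (taylor_coeff \<phi> 1))\<^sup>2"
  have c2: "norm (taylor_coeff \<phi> 2) \<le> 1 - ?x"
    by (rule Schwarz_second_coeff[OF hol \<open>\<phi> 0 = 0\<close> lt])
  have x: "0 \<le> 1 - ?x" using c2 norm_ge_zero order_trans by blast
  have "norm (of_real A * taylor_coeff \<phi> 2 + M * (taylor_coeff \<phi> 1)\<^sup>2)
      \<le> A * norm (taylor_coeff \<phi> 2) + norm M * ?x"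
    using \<open>0 \<le> A\<close> norm_triangle_ineq[of "of_real A * taylor_coeff \<phi> 2" "M * (taylor_coeff \<phi> 1)\<^sup>2"]
    unfolding norm_mult norm_power by simp
  also have "\<dots> \<le> A * (1 - ?x) + norm M * ?x"
    using c2 \<open>0 \<le> A\<close> by (simp add: mult_left_mono)
  also have "\<dots> \<le> max A (norm M) * (1 - ?x) + max A (norm M) * ?x"
    using x by (intro add_mono mult_right_mono) auto
  finally show ?thesis by (simp add: algebra_simps)
qed

section \<open>Coefficient relations\<close>

lemma taylor_coeff_subordinate:
  assumes p: "p holomorphic_on ball 0 1" and hol: "\<phi> holomorphic_on ball 0 1" and "\<phi> 0 = 0"
    and r: "\<And>z. norm z < 1 \<Longrightarrow> r z = p (\<phi> z)"
  shows "taylor_coeff r 1 = taylor_coeff p 1 * taylor_coeff \<phi> 1"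
    and "taylor_coeff r 2 =
      taylor_coeff p 1 * taylor_coeff \<phi> 2 + taylor_coeff p 2 * (taylor_coeff \<phi> 1)\<^sup>2"
proof -
  have c0: "taylor_coeff \<phi> 0 = 0" using \<open>\<phi> 0 = 0\<close> by (simp add: fps_expansion_def)
  have "p has_fps_expansion fps_expansion p 0" "\<phi> has_fps_expansion fps_expansion \<phi> 0"
    using has_fps_expansion_fps_expansion[OF open_ball _ p]
      has_fps_expansion_fps_expansion[OF open_ball _ hol] by simp_all
  hence "(p \<circ> \<phi>) has_fps_expansion fps_compose (fps_expansion p 0) (fps_expansion \<phi> 0)"
    using c0 by (intro has_fps_expansion_compose) auto
  moreover have "eventually (\<lambda>z. r z = (p \<circ> \<phi>) z) (nhds 0)"
    using eventually_nhds_in_open[OF open_ball, of 0 0 "1::real"] r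
    by (auto elim!: eventually_mono)
  ultimately have "r has_fps_expansion fps_compose (fps_expansion p 0) (fps_expansion \<phi> 0)"
    using has_fps_expansion_cong by blast
  hence E: "fps_expansion r 0 = fps_compose (fps_expansion p 0) (fps_expansion \<phi> 0)"
    by (rule fps_expansion_eqI)
  show "taylor_coeff r 1 = taylor_coeff p 1 * taylor_coeff \<phi> 1"
    by (simp add: E fps_compose_nth)
  show "taylor_coeff r 2 =
      taylor_coeff p 1 * taylor_coeff \<phi> 2 + taylor_coeff p 2 * (taylor_coeff \<phi> 1)\<^sup>2"
    using c0 by (simp add: E fps_compose_nth numeral_2_eq_2 fps_mult_nth power2_eq_square)
qed

text \<open>
  For \<open>g z = z G z\<close> with \<open>G\<close> the sum of \<open>B\<close>, the hypothesis on \<open>r\<close> is the equation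
  \<open>r z g z = z D\<^sub>q g z\<close> divided by \<open>z\<close>, a form without a singularity at 0. The operator
  \<open>z D\<^sub>q\<close> multiplies the coefficient of \<open>z\<^bsup>n+1\<^esup>\<close> in \<open>g\<close>, which is the \<open>n\<close>-th one of \<open>B\<close>, by \<open>[n + 1]\<close>.
\<close>

lemma q_quotient_coeffs:
  fixes B :: "complex fps"
  assumes q: "0 < q" "q < 1" and B: "fps_conv_radius B \<ge> 1" and hol: "r holomorphic_on ball 0 1"
    and r: "\<And>z. norm z < 1 \<Longrightarrow>
      r z * eval_fps B z = (eval_fps B z - of_real q * eval_fps B (of_real q * z)) / (1 - of_real q)"
  shows "(\<Sum>i=0..n. taylor_coeff r i * fps_nth B (n - i)) = of_real (q_num q (real n + 1)) * fps_nth B n"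
proof -
  have G: "eval_fps B has_fps_expansion B"
    using B by (intro eval_fps_has_fps_expansion) (auto intro: less_le_trans[of 0 1])
  have "(\<lambda>z. complex_of_real q * z) has_fps_expansion fps_const (of_real q) * fps_X"
    by (intro fps_expansion_intros)
  hence "(eval_fps B \<circ> (\<lambda>z. of_real q * z)) has_fps_expansion
      fps_compose B (fps_const (of_real q) * fps_X)"
    by (intro has_fps_expansion_compose G) auto
  hence Gq: "(\<lambda>z. eval_fps B (of_real q * z)) has_fps_expansion
      Abs_fps (\<lambda>n. of_real q ^ n * fps_nth B n)"
    by (simp add: fps_compose_linear o_def)
  have "r has_fps_expansion fps_expansion r 0"
    by (rule has_fps_expansion_fps_expansion[OF open_ball _ hol]) auto
  hence L: "(\<lambda>z. r z * eval_fps B z) has_fps_expansion fps_expansion r 0 * B"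
    by (intro fps_expansion_intros G)
  have "(\<lambda>z. (eval_fps B z - of_real q * eval_fps B (of_real q * z)) * (1 / (1 - of_real q)))
      has_fps_expansion
      (B - fps_const (of_real q) * Abs_fps (\<lambda>n. of_real q ^ n * fps_nth B n)) *
        fps_const (1 / (1 - of_real q))" (is "?H has_fps_expansion ?E")
    by (intro has_fps_expansion_mult has_fps_expansion_diff has_fps_expansion_const G Gq)
  moreover have ev: "eventually (\<lambda>z. r z * eval_fps B z = ?H z) (nhds 0)"
    using eventually_nhds_in_open[OF open_ball, of 0 0 "1::real"] r
    by (auto elim!: eventually_mono)
  ultimately have "(\<lambda>z. r z * eval_fps B z) has_fps_expansion ?E"
    by (simp only: has_fps_expansion_cong[OF ev refl])
  hence "fps_expansion r 0 * B = ?E"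
    by (rule fps_expansion_unique_complex[OF L])
  hence "fps_nth (fps_expansion r 0 * B) n = fps_nth ?E n" by simp
  also have "\<dots> = of_real (q_num q (real n + 1)) * fps_nth B n"
  proof -
    have "q_num q (real n + 1) = (1 - q * q ^ n) / (1 - q)"
      using q_num_of_nat[OF q(1), of "Suc n"] by (simp add: add.commute)
    show ?thesis
      unfolding \<open>q_num q (real n + 1) = _\<close> by (simp add: algebra_simps diff_divide_distrib)
  qed
  finally show ?thesis by (simp add: fps_mult_nth)
qed

lemma fps_conv_radius_mono:
  fixes F G :: "complex fps"
  assumes "\<And>n. norm (fps_nth G n) \<le> norm (fps_nth F n)"
  shows "fps_conv_radius F \<le> fps_conv_radius G"
  unfolding fps_conv_radius_def
proof (rule conv_radius_geI_ex')
  fix r :: real assume "0 < r" "ereal r < conv_radius (fps_nth F)"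
  hence "summable (\<lambda>n. norm (fps_nth F n * of_real r ^ n))"
    by (intro abs_summable_in_conv_radius) simp
  thus "summable (\<lambda>n. fps_nth G n * of_real r ^ n)"
    by (rule summable_comparison_test')
       (use assms in \<open>auto simp: norm_mult intro!: mult_right_mono\<close>)
qed

text \<open>
  Passing from the transform to its quotient by \<open>z\<close> turns the condition of not vanishing off 0 into
  not vanishing anywhere in the disc, since the quotient is 1 at 0.
\<close>

lemma q_integral_op_factorization:
  assumes q: "0 < q" "q < 1" "\<alpha> > 0" "\<beta> > -1" and f: "f \<in> class_A"
  defines "B \<equiv> Abs_fps (\<lambda>n. of_real (q_psi q \<alpha> \<beta> (n + 1)) * taylor_coeff f (n + 1))"
  shows "fps_conv_radius B \<ge> 1"
    and "norm z < 1 \<Longrightarrow> q_integral_op q \<alpha> \<beta> f z = z * eval_fps B z"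
    and "fps_nth B 0 = 1"
proof -
  have hol: "f holomorphic_on ball 0 1" and f': "deriv f 0 = 1" using f by (auto simp: class_A_def)
  have "1 \<le> fps_conv_radius (fps_expansion f 0)"
    using conv_radius_fps_expansion[of f 0 1] hol by (simp add: one_ereal_def)
  also have "\<dots> = fps_conv_radius (fps_shift 1 (fps_expansion f 0))" by simp
  also have "\<dots> \<le> fps_conv_radius B"
  proof (rule fps_conv_radius_mono)
    fix n
    show "norm (fps_nth B n) \<le> norm (fps_nth (fps_shift 1 (fps_expansion f 0)) n)"
      using q q_psi_pos[of q \<alpha> \<beta> "n + 1"] q_psi_le_1[of q \<alpha> \<beta> "n + 1"]
      by (auto simp: B_def norm_mult intro!: mult_left_le_one_le)
  qed
  finally show B1: "fps_conv_radius B \<ge> 1" .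
  show B0: "fps_nth B 0 = 1"
    using q_psi_eq_prod[of q \<alpha> \<beta> 1] q f' by (simp add: B_def fps_expansion_def)
  assume z: "norm z < 1"
  have zB: "norm z < fps_conv_radius B"
    using z B1 by (metis ereal_less(3) less_le_trans)
  have s: "(\<lambda>n. fps_nth B n * z ^ n) sums eval_fps B z" by (rule sums_eval_fps[OF zB])
  hence "(\<lambda>n. fps_nth B (Suc n) * z ^ Suc n) sums (eval_fps B z - 1)"
    using B0 sums_Suc_iff[of "\<lambda>n. fps_nth B n * z ^ n" "eval_fps B z - 1"] by simp
  hence "(\<lambda>n. z * (fps_nth B (Suc n) * z ^ Suc n)) sums (z * (eval_fps B z - 1))"
    by (rule sums_mult)
  hence "(\<lambda>n. of_real (q_psi q \<alpha> \<beta> (n + 2)) * taylor_coeff f (n + 2) * z ^ (n + 2)) sums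
      (z * (eval_fps B z - 1))"
    by (simp add: B_def mult_ac)
  thus "q_integral_op q \<alpha> \<beta> f z = z * eval_fps B z"
    unfolding q_integral_op_def by (simp add: sums_unique[symmetric] algebra_simps)
qed

text \<open>
  Subordination to \<open>p\<close> produces \<open>\<phi>\<close>. The two equations result from equating the coefficients of
  \<open>p \<circ> \<phi>\<close> with those of the \<open>q\<close>-logarithmic derivative of the transform; the square of the first
  coefficient of \<open>p\<close> comes from the product of the first-order terms in the recursion.
\<close>

lemma k_JUST_coeffs:
  assumes q: "0 < q" "q < 1" "\<alpha> > 0" "\<beta> > -1"
    and f: "f \<in> k_JUST k q \<alpha> \<beta> \<gamma>" and p: "is_conic_map k \<gamma> p"
  obtains \<phi> where "\<phi> holomorphic_on ball 0 1" "\<phi> 0 = 0"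
    "\<And>z. norm z < 1 \<Longrightarrow> norm (\<phi> z) < 1"
    "of_real ((q_num q 2 - 1) * q_psi q \<alpha> \<beta> 2) * taylor_coeff f 2 =
       taylor_coeff p 1 * taylor_coeff \<phi> 1"
    "of_real ((q_num q 3 - 1) * q_psi q \<alpha> \<beta> 3) * taylor_coeff f 3 =
       taylor_coeff p 1 * taylor_coeff \<phi> 2 +
       (taylor_coeff p 2 + (taylor_coeff p 1)\<^sup>2 / of_real (q_num q 2 - 1)) * (taylor_coeff \<phi> 1)\<^sup>2"
proof -
  have fA: "f \<in> class_A"
    and nz: "\<And>z. norm z < 1 \<Longrightarrow> z \<noteq> 0 \<Longrightarrow> q_integral_op q \<alpha> \<beta> f z \<noteq> 0"
    and Re: "\<And>z. norm z < 1 \<Longrightarrow>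
      Re (q_quotient q \<alpha> \<beta> f z) > k * cmod (q_quotient q \<alpha> \<beta> f z - 1) + \<gamma>"
    using f by (auto simp: k_JUST_def)
  define B where "B = Abs_fps (\<lambda>n. of_real (q_psi q \<alpha> \<beta> (n + 1)) * taylor_coeff f (n + 1))"
  define r where "r = q_quotient q \<alpha> \<beta> f"
  define H where "H z = (eval_fps B z - of_real q * eval_fps B (of_real q * z)) / (1 - of_real q)"
    for z
  note B = q_integral_op_factorization[OF q fA, folded B_def]
  have qz: "norm (of_real q * z) < 1" if "norm z < 1" for z :: complex
    using that q mult_strict_mono[of q 1 "norm z" 1] by (simp add: norm_mult)
  have q1: "1 - complex_of_real q \<noteq> 0" using q by (metis eq_iff_diff_eq_0 less_irrefl of_real_eq_1_iff)
  have Bnz: "eval_fps B z \<noteq> 0" if "norm z < 1" for z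
    using nz[OF that] B(2)[OF that] B(3) by (cases "z = 0") (auto simp: eval_fps_at_0)
  \<comment> \<open>The factor \<open>z\<close> cancels, so the value 1 prescribed at 0 is the one that continuity requires.\<close>
  have rB: "r z = H z / eval_fps B z" if z: "norm z < 1" for z
  proof (cases "z = 0")
    case True
    thus ?thesis using q1 B(3) by (simp add: r_def H_def q_quotient_def eval_fps_at_0)
  next
    case False
    thus ?thesis
      using q1 Bnz[OF z] B(2)[OF z] B(2)[OF qz[OF z]]
      by (simp add: r_def H_def q_quotient_def q_deriv_def field_simps)
  qed
  have sub: "ball (0::complex) 1 \<subseteq> eball 0 (fps_conv_radius B)"
  proof
    fix z :: complex assume "z \<in> ball 0 1"
    hence "ereal (norm z) < 1" by simp
    also note B(1)
    finally show "z \<in> eball 0 (fps_conv_radius B)" by (simp add: in_eball_iff)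
  qed
  have G: "eval_fps B holomorphic_on ball 0 1"
    by (rule holomorphic_on_eval_fps[OF sub])
  have "(eval_fps B \<circ> (\<lambda>z. of_real q * z)) holomorphic_on ball 0 1"
    by (rule holomorphic_on_compose_gen[OF _ G]) (use qz in \<open>auto intro!: holomorphic_intros\<close>)
  hence "(\<lambda>z. H z / eval_fps B z) holomorphic_on ball 0 1"
    unfolding H_def o_def using q1 Bnz by (intro holomorphic_intros G) auto
  hence holr: "r holomorphic_on ball 0 1"
    by (rule holomorphic_transform) (simp add: rB)
  have r0: "r 0 = 1" by (simp add: r_def q_quotient_def)
  have "r ` ball 0 1 \<subseteq> conic_domain k \<gamma>"
    using Re by (auto simp: conic_domain_def r_def cmod_def)
  from is_conic_map_subordination[OF p holr this r0] obtain \<phi>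
    where \<phi>: "\<phi> holomorphic_on ball 0 1" "\<phi> 0 = 0" "\<And>z. norm z < 1 \<Longrightarrow> norm (\<phi> z) < 1"
      and rp: "\<And>z. norm z < 1 \<Longrightarrow> r z = p (\<phi> z)" by metis
  have holp: "p holomorphic_on ball 0 1" using p by (simp add: is_conic_map_def)
  note rc = taylor_coeff_subordinate[OF holp \<phi>(1,2) rp]
  have "r z * eval_fps B z = H z" if "norm z < 1" for z
    using rB[OF that] Bnz[OF that] by simp
  hence rec: "(\<Sum>i=0..n. taylor_coeff r i * fps_nth B (n - i)) =
      of_real (q_num q (real n + 1)) * fps_nth B n" for n
    using q_quotient_coeffs[OF q(1,2) B(1) holr] by (simp add: H_def)
  have r0': "taylor_coeff r 0 = 1" using r0 by (simp add: fps_expansion_def)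
  have e1: "taylor_coeff r 1 = of_real (q_num q 2 - 1) * fps_nth B 1"
    using rec[of 1] r0' B(3) by (simp add: algebra_simps)
  have e2: "fps_nth B 2 + taylor_coeff r 1 * fps_nth B 1 + taylor_coeff r 2 =
      of_real (q_num q 3) * fps_nth B 2"
    using rec[of 2] r0' B(3) by (simp add: numeral_2_eq_2)
  have b: "fps_nth B 1 = of_real (q_psi q \<alpha> \<beta> 2) * taylor_coeff f 2"
      "fps_nth B 2 = of_real (q_psi q \<alpha> \<beta> 3) * taylor_coeff f 3"
    by (simp_all add: B_def numeral_2_eq_2 numeral_3_eq_3)
  have Q: "complex_of_real (q_num q 2 - 1) \<noteq> 0" using q by (simp add: q_num_2_minus_1)
  have "fps_nth B 1 = taylor_coeff r 1 / of_real (q_num q 2 - 1)"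
    using e1 Q by simp
  hence "of_real (q_num q 3 - 1) * fps_nth B 2 =
      taylor_coeff r 2 + (taylor_coeff r 1)\<^sup>2 / of_real (q_num q 2 - 1)"
    using e2 by (simp add: algebra_simps power2_eq_square)
  also have "\<dots> = taylor_coeff p 1 * taylor_coeff \<phi> 2 +
       (taylor_coeff p 2 + (taylor_coeff p 1)\<^sup>2 / of_real (q_num q 2 - 1)) * (taylor_coeff \<phi> 1)\<^sup>2"
    using rc by (simp add: power_mult_distrib distrib_right)
  finally have "of_real ((q_num q 3 - 1) * q_psi q \<alpha> \<beta> 3) * taylor_coeff f 3 =
       taylor_coeff p 1 * taylor_coeff \<phi> 2 +
       (taylor_coeff p 2 + (taylor_coeff p 1)\<^sup>2 / of_real (q_num q 2 - 1)) * (taylor_coeff \<phi> 1)\<^sup>2"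
    by (simp add: b mult_ac)
  moreover have "of_real ((q_num q 2 - 1) * q_psi q \<alpha> \<beta> 2) * taylor_coeff f 2 =
       taylor_coeff p 1 * taylor_coeff \<phi> 1"
    using e1 rc(1) by (simp add: b[unfolded One_nat_def] mult_ac)
  ultimately show ?thesis using that \<phi> by blast
qed

section \<open>The Fekete--Szego inequality\<close>

theorem theorem2p11:
  fixes q k \<alpha> \<beta> \<gamma> \<eta> P1 P2 \<psi>2 \<psi>3 \<sigma>1 \<sigma>2 :: real
    and f p :: "complex \<Rightarrow> complex" and a :: "nat \<Rightarrow> complex"
  assumes "0 \<le> \<gamma>" "\<gamma> < 1" "0 < q" "q < 1" "k \<ge> 0" "\<alpha> > 0" "\<beta> > -1"
    and f: "f \<in> k_JUST k q \<alpha> \<beta> \<gamma>"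
    and a: "a = taylor_coeff f"
    and p: "is_conic_map k \<gamma> p"
    and P1: "P1 = Re (taylor_coeff p 1)"
    and P2: "P2 = Re (taylor_coeff p 2)"
    and \<psi>2: "\<psi>2 = q_psi q \<alpha> \<beta> 2"
    and \<psi>3: "\<psi>3 = q_psi q \<alpha> \<beta> 3"
    and \<sigma>1: "\<sigma>1 = (q_num q 2 - 1)\<^sup>2 * \<psi>2\<^sup>2 / ((q_num q 3 - 1) * \<psi>3) *
                  (P2 / P1\<^sup>2 + 1 / (q_num q 2 - 1) - 1 / P1)"
    and \<sigma>2: "\<sigma>2 = (q_num q 2 - 1)\<^sup>2 * \<psi>2\<^sup>2 / ((q_num q 3 - 1) * \<psi>3) *
                  (P2 / P1\<^sup>2 + 1 / (q_num q 2 - 1) + 1 / P1)"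
  shows "(\<eta> \<le> \<sigma>1 \<longrightarrow>
           cmod (a 3 - of_real \<eta> * (a 2)\<^sup>2) \<le> 1 / ((q_num q 3 - 1) * \<psi>3) *
             (P2 + P1\<^sup>2 / (q_num q 2 - 1)
               - \<eta> * (P1\<^sup>2 * (q_num q 3 - 1) * \<psi>3 / ((q_num q 2 - 1)\<^sup>2 * \<psi>2\<^sup>2)))) \<and>
         (\<sigma>1 \<le> \<eta> \<and> \<eta> \<le> \<sigma>2 \<longrightarrow>
           cmod (a 3 - of_real \<eta> * (a 2)\<^sup>2) \<le> 1 / ((q_num q 3 - 1) * \<psi>3) * P1) \<and>
         (\<sigma>2 \<le> \<eta> \<longrightarrow>
           cmod (a 3 - of_real \<eta> * (a 2)\<^sup>2) \<le> 1 / ((q_num q 3 - 1) * \<psi>3) *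
             (- P2 - P1\<^sup>2 / (q_num q 2 - 1)
               + \<eta> * (P1\<^sup>2 * (q_num q 3 - 1) * \<psi>3 / ((q_num q 2 - 1)\<^sup>2 * \<psi>2\<^sup>2))))"
proof -
  define N where "N = q_num q 2 - 1"
  define T where "T = q_num q 3 - 1"
  have pos: "0 < N" "0 < T" "0 < \<psi>2" "0 < \<psi>3"
    using \<open>0 < q\<close> \<open>q < 1\<close> \<open>\<alpha> > 0\<close> \<open>\<beta> > -1\<close>
    by (auto simp: N_def T_def \<psi>2 \<psi>3 q_num_2_minus_1 q_num_3_minus_1 intro!: q_psi_pos)
  have "P1 > 0"
    using p by (simp add: P1 is_conic_map_def fps_expansion_def)
  have p12: "taylor_coeff p 1 = of_real P1" "taylor_coeff p 2 = of_real P2"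
    using is_conic_map_taylor_coeff_real[OF p] by (simp_all add: P1 P2 del: One_nat_def)
  obtain \<phi> where \<phi>: "\<phi> holomorphic_on ball 0 1" "\<phi> 0 = 0"
      "\<And>z. norm z < 1 \<Longrightarrow> norm (\<phi> z) < 1"
    and a2: "of_real (N * \<psi>2) * a 2 = of_real P1 * taylor_coeff \<phi> 1"
    and a3: "of_real (T * \<psi>3) * a 3 = of_real P1 * taylor_coeff \<phi> 2 +
       of_real (P2 + P1\<^sup>2 / N) * (taylor_coeff \<phi> 1)\<^sup>2"
    using k_JUST_coeffs[OF \<open>0 < q\<close> \<open>q < 1\<close> \<open>\<alpha> > 0\<close> \<open>\<beta> > -1\<close> f p]
    unfolding p12 a[symmetric] \<psi>2[symmetric] \<psi>3[symmetric] N_def[symmetric] T_def[symmetric]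
    by (metis of_real_add of_real_divide of_real_power)
  define K where "K = P1\<^sup>2 * T * \<psi>3 / (N\<^sup>2 * \<psi>2\<^sup>2)"
  define M where "M = P2 + P1\<^sup>2 / N - \<eta> * K"
  have "K > 0" using pos \<open>P1 > 0\<close> by (simp add: K_def)
  have "a 2 = of_real (P1 / (N * \<psi>2)) * taylor_coeff \<phi> 1"
    using a2 pos by (simp add: field_simps)
  hence "of_real (T * \<psi>3) * (a 2)\<^sup>2 = of_real K * (taylor_coeff \<phi> 1)\<^sup>2"
    by (simp add: K_def power_mult_distrib power_divide)
  hence "of_real (T * \<psi>3) * (a 3 - of_real \<eta> * (a 2)\<^sup>2) =
      of_real P1 * taylor_coeff \<phi> 2 + of_real M * (taylor_coeff \<phi> 1)\<^sup>2"
    using a3 by (simp add: M_def algebra_simps)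
  hence "norm (of_real (T * \<psi>3) * (a 3 - of_real \<eta> * (a 2)\<^sup>2)) \<le> max P1 \<bar>M\<bar>"
    using Fekete_Szego_Schwarz[OF \<phi>, of P1 "of_real M"] \<open>P1 > 0\<close> by simp
  hence bound: "cmod (a 3 - of_real \<eta> * (a 2)\<^sup>2) \<le> 1 / (T * \<psi>3) * max P1 \<bar>M\<bar>"
    using pos unfolding norm_mult norm_of_real by (simp add: field_simps)
  have \<sigma>: "K * \<sigma>1 = P2 + P1\<^sup>2 / N - P1" "K * \<sigma>2 = P2 + P1\<^sup>2 / N + P1"
    unfolding \<sigma>1 \<sigma>2 K_def N_def[symmetric] T_def[symmetric]
    using pos \<open>P1 > 0\<close> by (simp_all add: field_simps power2_eq_square)
  have "M \<ge> P1" if "\<eta> \<le> \<sigma>1"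
    using mult_left_mono[OF that, of K] \<open>K > 0\<close> \<sigma> by (simp add: M_def mult.commute)
  moreover have "\<bar>M\<bar> \<le> P1" if "\<sigma>1 \<le> \<eta>" "\<eta> \<le> \<sigma>2"
    using mult_left_mono[OF that(1), of K] mult_left_mono[OF that(2), of K] \<open>K > 0\<close> \<sigma>
    by (simp add: M_def mult.commute)
  moreover have "- M \<ge> P1" if "\<sigma>2 \<le> \<eta>"
    using mult_left_mono[OF that, of K] \<open>K > 0\<close> \<sigma> by (simp add: M_def mult.commute)
  ultimately have m: "\<eta> \<le> \<sigma>1 \<Longrightarrow> max P1 \<bar>M\<bar> = M" "\<sigma>1 \<le> \<eta> \<Longrightarrow> \<eta> \<le> \<sigma>2 \<Longrightarrow> max P1 \<bar>M\<bar> = P1"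
      "\<sigma>2 \<le> \<eta> \<Longrightarrow> max P1 \<bar>M\<bar> = - P2 - P1\<^sup>2 / N + \<eta> * K"
    using \<open>P1 > 0\<close> by (auto simp: max_def M_def)
  show ?thesis
    unfolding N_def[symmetric] T_def[symmetric] K_def[symmetric] M_def[symmetric]
    using bound m by auto
qed

end
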